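(* Let $\mathcal{K}_g\subseteq\mathbb{P}^2(\mathbb{F}_q)$ be a generalized $k$-arc with $q\geq 5$. If $\mathcal{K}_g$ is complete as a generalized arc, then $$k\geq \begin{cases}\lceil t_1\rceil & \text{if } \mathcal{K}_g \text{ is also a } k\text{-arc},\\ \lceil t_2\rceil & \text{if } \mathcal{K}_g \text{ is not a } k\text{-arc},\end{cases}$$ where $t_1$ and $t_2$ are the minimum real positive solutions of the following inequalities: $$\binom{t_1}{5}(q-4)+t_1\geq q^2+q+1,\quad\text{and}$$ $$\binom{t_2-3}{5}(q-4)+\binom{t_2-2}{4}(6q-12)+\binom{t_2-3}{2}(q-2)+t_2\geq q^2+3 .$$ In particular, $t_g(2,q)\geq\min\{\lceil t_1\rceil,\lceil t_2\rceil\}$.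
   Context: $\mathbb{F}_q$ is the field with $q$ elements ($q$ a prime power) and $\mathbb{P}^2(\mathbb{F}_q)$ is the projective plane over it. A conic is the zero set in $\mathbb{P}^2(\mathbb{F}_q)$ of a nonzero homogeneous quadratic form over $\mathbb{F}_q$; it may be reducible (e.g. a union of two lines). A $k$-arc is a set of $k$ points of $\mathbb{P}^2(\mathbb{F}_q)$ no three of which lie on a line. A generalized $k$-arc is a set of $k$ points of $\mathbb{P}^2(\mathbb{F}_q)$ such that no six of them lie on a (possibly reducible) conic. It is complete (as a generalized arc) if it is not contained in a generalized $(k+1)$-arc. $t_g(2,q)$ denotes the size of the smallest complete generalized $k$-arc in $\mathbb{P}^2(\mathbb{F}_q)$. For real $t$ and an integer $j\ge 0$, $\binom{t}{j}=t(t-1)\cdots(t-j+1)/j!$.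
   Formalization: Generalized k-arcs are taken with k ≥ 6 (5 points, 4 of them collinear, refute the claim for q ≥ 16), and t_1, t_2 are infima of the positive solutions; for q ≤ 13 no minimum t_2 exists, the infimum is 0, and the non-arc and t_g bounds are then trivial. *)

theory Defs
  imports "HOL-Analysis.Cartesian_Space"
begin

definition proj_plane :: "('a::field ^ 3) set set" where
  "proj_plane = {vec.span {v} | v. v \<noteq> 0}"

definition linear_form :: "'a::field \<Rightarrow> 'a \<Rightarrow> 'a \<Rightarrow> 'a ^ 3 \<Rightarrow> 'a" where
  "linear_form a b c x = a * x$1 + b * x$2 + c * x$3"

definition quadratic_form ::
  "'a::field \<Rightarrow> 'a \<Rightarrow> 'a \<Rightarrow> 'a \<Rightarrow> 'a \<Rightarrow> 'a \<Rightarrow> 'a ^ 3 \<Rightarrow> 'a" where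
  "quadratic_form a b c d e f x =
     a * (x$1)^2 + b * (x$2)^2 + c * (x$3)^2 + d * (x$1 * x$2) + e * (x$1 * x$3) + f * (x$2 * x$3)"

text \<open>Only used for homogeneous \<open>F\<close>, where vanishing at one nonzero representative
  of a point is the same as vanishing at all of them.\<close>

definition zero_set :: "('a::field ^ 3 \<Rightarrow> 'a) \<Rightarrow> ('a ^ 3) set set" where
  "zero_set F = {P \<in> proj_plane. \<forall>x\<in>P. F x = 0}"

definition is_line :: "('a::field ^ 3) set set \<Rightarrow> bool" where
  "is_line L \<longleftrightarrow> (\<exists>a b c. (a, b, c) \<noteq> (0, 0, 0) \<and> L = zero_set (linear_form a b c))"

text \<open>A form is nonzero when its coefficients are not all zero. Reducible forms are allowed, and so
  are forms whose zero set has few rational points, e.g. two conjugate lines.\<close>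

definition is_conic :: "('a::field ^ 3) set set \<Rightarrow> bool" where
  "is_conic C \<longleftrightarrow> (\<exists>a b c d e f. (a, b, c, d, e, f) \<noteq> (0, 0, 0, 0, 0, 0) \<and>
     C = zero_set (quadratic_form a b c d e f))"

definition is_arc :: "nat \<Rightarrow> ('a::field ^ 3) set set \<Rightarrow> bool" where
  "is_arc k K \<longleftrightarrow> K \<subseteq> proj_plane \<and> finite K \<and> card K = k \<and>
     \<not> (\<exists>S L. S \<subseteq> K \<and> card S = 3 \<and> is_line L \<and> S \<subseteq> L)"

text \<open>The condition on six points presupposes \<open>k \<ge> 6\<close>, which is made explicit here. Without it,
  five points of which four are collinear would vacuously be a generalized arc, and a complete one:
  the line through the four, together with the line joining the fifth to any further point,
  is a conic. Every smaller set can be extended, so there would be a complete generalized arc of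
  size 5 over every field.\<close>

definition is_generalized_arc :: "nat \<Rightarrow> ('a::field ^ 3) set set \<Rightarrow> bool" where
  "is_generalized_arc k K \<longleftrightarrow> 6 \<le> k \<and> K \<subseteq> proj_plane \<and> finite K \<and> card K = k \<and>
     \<not> (\<exists>S C. S \<subseteq> K \<and> card S = 6 \<and> is_conic C \<and> S \<subseteq> C)"

definition is_complete_generalized_arc :: "nat \<Rightarrow> ('a::field ^ 3) set set \<Rightarrow> bool" where
  "is_complete_generalized_arc k K \<longleftrightarrow>
     is_generalized_arc k K \<and> \<not> (\<exists>K'. is_generalized_arc (k + 1) K' \<and> K \<subseteq> K')"

definition smallest_complete_size :: "'a::{field,finite} itself \<Rightarrow> nat" where
  "smallest_complete_size _ =
     (LEAST k. \<exists>K :: ('a ^ 3) set set. is_complete_generalized_arc k K)"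

definition solutions1 :: "nat \<Rightarrow> real set" where
  "solutions1 q = {t. 0 < t \<and>
     (t gchoose 5) * (real q - 4) + t \<ge> (real q)^2 + real q + 1}"

definition solutions2 :: "nat \<Rightarrow> real set" where
  "solutions2 q = {t. 0 < t \<and>
     ((t - 3) gchoose 5) * (real q - 4) + ((t - 2) gchoose 4) * (6 * real q - 12)
       + ((t - 3) gchoose 2) * (real q - 2) + t \<ge> (real q)^2 + 3}"

text \<open>The infimum is the minimum whenever a minimum exists. The sets are closed except possibly
  at 0, and 0 is a limit point only of \<open>solutions2 q\<close> for \<open>5 \<le> q < 16\<close>: the polynomial on the
  left-hand side tends to \<open>15 * q + 12\<close> at 0, so there every small positive \<open>t\<close> is a solution,
  no minimum exists, and the infimum is 0.\<close>

definition t1 :: "nat \<Rightarrow> real" where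
  "t1 q = Inf (solutions1 q)"

definition t2 :: "nat \<Rightarrow> real" where
  "t2 q = Inf (solutions2 q)"

end

theory Submission imports Defs begin

text \<open>Let \<open>K\<close> be a complete generalized \<open>k\<close>-arc. No point outside \<open>K\<close> can be added, so each such
  point lies on a conic with five points of \<open>K\<close> (\<open>complete_arc_covers\<close>): the conics through the
  five-point subsets of \<open>K\<close> cover the plane. Bounding how many new points each of them covers and
  comparing with the size of the plane gives an inequality that says that \<open>k\<close> is one of the
  solutions whose infimum is \<open>t1 q\<close> or \<open>t2 q\<close>.

  If \<open>K\<close> is an arc, five points of \<open>K\<close> determine a unique conic, which is irreducible and has at
  most \<open>q + 1\<close> points, hence at most \<open>q - 4\<close> new ones (\<open>card_conic_closure_arc\<close>). There are
  \<open>k choose 5\<close> such conics, and they and \<open>K\<close> cover \<open>q\<^sup>2 + q + 1\<close> points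
  (\<open>complete_arc_bound\<close>).

  If \<open>K\<close> is not an arc, some line \<open>L\<close> contains three of its points. As pairs of lines are conics,
  \<open>K\<close> has no four collinear points and no two disjoint collinear triples. Counting the points off
  \<open>L\<close> only, the contribution of a five-point subset depends on how many of its points lie on
  \<open>L\<close> (\<open>complete_nonarc_bound\<close>).

  The geometry of conics is elementary and rests on one fact
  (\<open>vanishes_on_line_and_triangle\<close>): a quadratic form that vanishes on a line and at three
  noncollinear points off it is zero. It yields uniqueness, irreducibility, and the description of
  the conics through a set with a collinear triple as pairs of lines. The bound on the number of
  points comes from projecting a conic from one of its points (\<open>card_conic_le\<close>).

  For the bound on the smallest size a complete generalized arc must exist. Six points that lie on
  no conic form a generalized arc, and one of maximal size is complete
  (\<open>complete_generalized_arc_exists\<close>).\<close>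

section \<open>Linear algebra in dimension three\<close>

definition dot :: "'a::field ^ 3 \<Rightarrow> 'a ^ 3 \<Rightarrow> 'a" where
  "dot l x = l$1 * x$1 + l$2 * x$2 + l$3 * x$3"

definition cross :: "'a::field ^ 3 \<Rightarrow> 'a ^ 3 \<Rightarrow> 'a ^ 3" where
  "cross x y = vector [x$2 * y$3 - x$3 * y$2, x$3 * y$1 - x$1 * y$3, x$1 * y$2 - x$2 * y$1]"

lemma cross_component [simp]:
  "cross x y $ 1 = x$2 * y$3 - x$3 * y$2"
  "cross x y $ 2 = x$3 * y$1 - x$1 * y$3"
  "cross x y $ 3 = x$1 * y$2 - x$2 * y$1"
  by (simp_all add: cross_def)

lemma vec3_eq_iff: "x = y \<longleftrightarrow> x$1 = y$1 \<and> x$2 = y$2 \<and> x$3 = y$3" for x y :: "'a ^ 3"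
  by (simp add: vec_eq_iff forall_3)

lemma dot_linear [simp]:
  "dot l (x + y) = dot l x + dot l y" "dot l (x - y) = dot l x - dot l y"
  "dot l (c *s x) = c * dot l x" "dot l 0 = 0" "dot 0 x = 0"
  by (simp_all add: dot_def algebra_simps)

lemma dot_cross [simp]: "dot (cross x y) x = 0" "dot (cross x y) y = 0"
  "dot x (cross x y) = 0" "dot y (cross x y) = 0"
  by (simp_all add: dot_def algebra_simps)

lemma dot_nonzero: "l \<noteq> 0 \<Longrightarrow> \<exists>x. dot l x \<noteq> 0"
proof (rule ccontr)
  assume l: "l \<noteq> 0" and "\<nexists>x. dot l x \<noteq> 0"
  then have "dot l (vector [1,0,0]) = 0" "dot l (vector [0,1,0]) = 0" "dot l (vector [0,0,1]) = 0"
    by blast+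
  with l show False by (simp add: dot_def vec3_eq_iff)
qed

text \<open>Cramer's rule: the three coefficients are quotients of determinants, and
  \<open>dot (cross x y) z\<close> is the determinant of \<open>x\<close>, \<open>y\<close>, \<open>z\<close>. Its vanishing is
  the form in which collinearity of three points appears below.\<close>

lemma cramer:
  assumes "dot (cross x y) z \<noteq> 0"
  shows "\<exists>\<alpha> \<beta> \<gamma>. v = \<alpha> *s x + \<beta> *s y + \<gamma> *s z"
proof -
  let ?D = "dot (cross x y) z"
  have "?D *s v = dot (cross y z) v *s x + dot (cross z x) v *s y + dot (cross x y) v *s z"
    by (simp add: vec3_eq_iff dot_def) algebra
  then have "inverse ?D *s (?D *s v) = inverse ?D *s (dot (cross y z) v *s x + dot (cross z x) v *s y + dot (cross x y) v *s z)"
    by (rule arg_cong)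
  then have "v = inverse ?D *s (dot (cross y z) v *s x + dot (cross z x) v *s y + dot (cross x y) v *s z)"
    using assms by simp
  then have "v = (inverse ?D * dot (cross y z) v) *s x + (inverse ?D * dot (cross z x) v) *s y
      + (inverse ?D * dot (cross x y) v) *s z"
    by (simp add: vector_add_ldistrib)
  then show ?thesis by (intro exI)
qed

lemma span_scale:
  assumes "c \<noteq> 0"
  shows "vec.span {c *s x} = vec.span {x :: 'a::field ^ 3}"
proof
  show "vec.span {c *s x} \<subseteq> vec.span {x}"
    unfolding vec.span_singleton by auto
  have "k *s x = (k / c) *s (c *s x)" for k using assms by simp
  then show "vec.span {x} \<subseteq> vec.span {c *s x}"
    unfolding vec.span_singleton by blast
qed

lemma cross_zero_span:
  assumes "x \<noteq> 0" "y \<noteq> 0" "cross x y = 0"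
  shows "vec.span {x} = vec.span {y}"
proof -
  have *: "x $ i *s y = y $ i *s x" for i
    using assms(3) exhaust_3[of i] by (auto simp: vec3_eq_iff algebra_simps)
  obtain i where i: "x $ i \<noteq> 0" using assms(1) by (auto simp: vec_eq_iff)
  have "y = inverse (x $ i) *s (x $ i *s y)" using i by simp
  then have y: "y = (inverse (x $ i) * y $ i) *s x" using * by simp
  then have "inverse (x $ i) * y $ i \<noteq> 0" using assms(2) by auto
  then show ?thesis
    using y span_scale by metis
qed

text \<open>A nonzero linear form has a two-dimensional kernel: complete \<open>x\<close>, \<open>y\<close> to a
  basis by \<open>w\<close>; the form cannot vanish at \<open>w\<close> too, so the coefficient of \<open>w\<close> in any
  kernel vector is 0.\<close>

lemma on_line_combination:
  assumes "cross x y \<noteq> 0" "l \<noteq> 0" "dot l x = 0" "dot l y = 0" "dot l z = 0"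
  shows "\<exists>\<alpha> \<beta>. z = \<alpha> *s x + \<beta> *s y"
proof -
  obtain w where w: "dot (cross x y) w \<noteq> 0" using dot_nonzero assms(1) by blast
  then have lw: "dot l w \<noteq> 0"
  proof -
    obtain v where v: "dot l v \<noteq> 0" using dot_nonzero assms(2) by blast
    obtain a b c where "v = a *s x + b *s y + c *s w" using cramer[OF w] by blast
    with v assms show ?thesis by auto
  qed
  obtain a b c where z: "z = a *s x + b *s y + c *s w" using cramer[OF w] by blast
  then have "c = 0" using assms lw by simp
  then show ?thesis using z by auto
qed

text \<open>The kernel of a linear form is never just the line spanned by \<open>p\<close>. This is clear for
  \<open>m = 0\<close>. Otherwise all the vectors
  \<open>cross m e\<close> would be multiples of \<open>p\<close>, and
  \<open>cross p (cross m e) = p$i *s m - dot m p *s e\<close>, for \<open>e\<close> the \<open>i\<close>-th unit vector, would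
  force \<open>p = 0\<close>. With \<open>m\<close> the polar form of a conic at \<open>p\<close>, this produces a tangent direction.\<close>

lemma independent_in_kernel:
  assumes "p \<noteq> 0" "dot m p = 0"
  shows "\<exists>r. dot m r = 0 \<and> cross p r \<noteq> 0"
proof (rule ccontr)
  assume "\<nexists>r. dot m r = 0 \<and> cross p r \<noteq> 0"
  then have H: "cross p r = 0" if "dot m r = 0" for r using that by blast
  show False
  proof (cases "m = 0")
    case True
    then have "cross p r = 0" for r by (auto intro: H simp: dot_def)
    from this[of "vector [1,0,0]"] this[of "vector [0,1,0]"] this[of "vector [0,0,1]"]
    show False using assms(1) by (simp add: vec3_eq_iff)
  next
    case False
    have "p $ 1 *s m = cross p (cross m (vector [1,0,0])) + dot m p *s vector [1,0,0]"
      "p $ 2 *s m = cross p (cross m (vector [0,1,0])) + dot m p *s vector [0,1,0]"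
      "p $ 3 *s m = cross p (cross m (vector [0,0,1])) + dot m p *s vector [0,0,1]"
      by (simp_all add: vec3_eq_iff dot_def algebra_simps)
    moreover have "cross p (cross m e) = 0" for e by (rule H) simp
    ultimately have "p $ 1 *s m = 0" "p $ 2 *s m = 0" "p $ 3 *s m = 0"
      using assms(2) by simp_all
    then show False using False assms(1) by (auto simp: vec3_eq_iff)
  qed
qed

section \<open>Quadratic forms as functions\<close>

definition is_quadratic :: "('a::field ^ 3 \<Rightarrow> 'a) \<Rightarrow> bool" where
  "is_quadratic Q \<longleftrightarrow> (\<exists>a b c d e f. Q = quadratic_form a b c d e f)"

text \<open>The symmetric bilinear form of \<open>Q\<close>, without a factor \<open>1/2\<close>, so that characteristic 2 needs no
  separate treatment.\<close>

definition polar :: "('a::field ^ 3 \<Rightarrow> 'a) \<Rightarrow> 'a ^ 3 \<Rightarrow> 'a ^ 3 \<Rightarrow> 'a" where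
  "polar Q x y = Q (x + y) - Q x - Q y"

lemma quadratic_combination:
  assumes "is_quadratic Q"
  shows "Q (\<alpha> *s x + \<beta> *s y) = \<alpha>\<^sup>2 * Q x + \<beta>\<^sup>2 * Q y + \<alpha> * \<beta> * polar Q x y"
  using assms unfolding is_quadratic_def polar_def
  by (auto simp: quadratic_form_def power2_eq_square algebra_simps)

lemma quadratic_combination3:
  assumes "is_quadratic Q"
  shows "Q (\<alpha> *s x + \<beta> *s y + \<gamma> *s z) = \<alpha>\<^sup>2 * Q x + \<beta>\<^sup>2 * Q y + \<gamma>\<^sup>2 * Q z
    + \<alpha> * \<beta> * polar Q x y + \<alpha> * \<gamma> * polar Q x z + \<beta> * \<gamma> * polar Q y z"
  using assms unfolding is_quadratic_def polar_def
  by (auto simp: quadratic_form_def power2_eq_square algebra_simps)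

lemma quadratic_scale: "is_quadratic Q \<Longrightarrow> Q (c *s x) = c\<^sup>2 * Q x"
  using quadratic_combination[of Q c x 0 0] by simp

lemma polar_linear:
  assumes "is_quadratic Q"
  shows "\<exists>m. \<forall>y. polar Q p y = dot m y"
proof -
  obtain a b c d e f where Q: "Q = quadratic_form a b c d e f"
    using assms is_quadratic_def by blast
  have "polar Q p y = dot (vector [2*a*p$1 + d*p$2 + e*p$3, 2*b*p$2 + d*p$1 + f*p$3,
      2*c*p$3 + e*p$1 + f*p$2]) y" for y
    by (simp add: Q polar_def dot_def quadratic_form_def power2_eq_square algebra_simps)
  then show ?thesis by blast
qed

lemma polar_self: "is_quadratic Q \<Longrightarrow> polar Q p p = 2 * Q p"
  using quadratic_scale[of Q 2 p] by (simp add: polar_def vector_sadd_rdistrib[of 1 1 p, simplified])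

text \<open>The six vectors \<open>e\<^sub>i\<close>, \<open>e\<^sub>i + e\<^sub>j\<close> impose independent conditions on the six
  coefficients. Hence a form whose coefficients are not all zero is a nonzero function, over every field, and
  the coefficients can be forgotten.\<close>

lemma quadratic_form_zero_coefficients:
  assumes "\<And>x. quadratic_form a b c d e f x = 0"
  shows "(a, b, c, d, e, f) = (0, 0, 0, 0, 0, 0)"
  using assms[of "vector [1,0,0]"] assms[of "vector [0,1,0]"] assms[of "vector [0,0,1]"]
    assms[of "vector [1,1,0]"] assms[of "vector [1,0,1]"] assms[of "vector [0,1,1]"]
  by (simp add: quadratic_form_def)

lemma is_conic_iff:
  "is_conic C \<longleftrightarrow> (\<exists>Q. is_quadratic Q \<and> (\<exists>x. Q x \<noteq> 0) \<and> C = zero_set Q)"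
proof
  assume "is_conic C"
  then obtain a b c d e f where *: "(a, b, c, d, e, f) \<noteq> (0, 0, 0, 0, 0, 0)"
    "C = zero_set (quadratic_form a b c d e f)"
    unfolding is_conic_def by blast
  have "\<exists>x. quadratic_form a b c d e f x \<noteq> 0"
    by (rule ccontr) (use * quadratic_form_zero_coefficients[of a b c d e f] in simp)
  with * show "\<exists>Q. is_quadratic Q \<and> (\<exists>x. Q x \<noteq> 0) \<and> C = zero_set Q"
    unfolding is_quadratic_def by blast
next
  assume "\<exists>Q. is_quadratic Q \<and> (\<exists>x. Q x \<noteq> 0) \<and> C = zero_set Q"
  then obtain a b c d e f x where "quadratic_form a b c d e f x \<noteq> 0"
     "C = zero_set (quadratic_form a b c d e f)"
    unfolding is_quadratic_def by blast
  moreover from this have "(a, b, c, d, e, f) \<noteq> (0, 0, 0, 0, 0, 0)"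
    by (auto simp: quadratic_form_def)
  ultimately show "is_conic C" unfolding is_conic_def by blast
qed

lemma is_line_iff: "is_line L \<longleftrightarrow> (\<exists>l. l \<noteq> 0 \<and> L = zero_set (dot l))"
proof
  assume "is_line L"
  then obtain a b c where abc: "(a, b, c) \<noteq> (0, 0, 0)" "L = zero_set (linear_form a b c)"
    unfolding is_line_def by blast
  have "linear_form a b c = dot (vector [a,b,c])" by (auto simp: linear_form_def dot_def)
  moreover have "vector [a,b,c] \<noteq> (0 :: 'a ^ 3)" using abc(1) by (auto simp: vec3_eq_iff)
  ultimately show "\<exists>l. l \<noteq> 0 \<and> L = zero_set (dot l)" using abc(2) by metis
next
  assume "\<exists>l. l \<noteq> 0 \<and> L = zero_set (dot l)"
  then obtain l where l: "l \<noteq> 0" "L = zero_set (dot l)" by blast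
  have "dot l = linear_form (l$1) (l$2) (l$3)" by (auto simp: linear_form_def dot_def)
  then show "is_line L" using l unfolding is_line_def by (force simp: vec3_eq_iff)
qed

lemma product_of_linear_forms:
  assumes "l \<noteq> 0" "m \<noteq> 0"
  shows "is_quadratic (\<lambda>x. dot l x * dot m x)" "\<exists>x. dot l x * dot m x \<noteq> 0"
proof -
  have *: "(\<lambda>x. dot l x * dot m x) = quadratic_form (l$1*m$1) (l$2*m$2) (l$3*m$3)
    (l$1*m$2 + l$2*m$1) (l$1*m$3 + l$3*m$1) (l$2*m$3 + l$3*m$2)"
    by (auto simp: quadratic_form_def dot_def power2_eq_square algebra_simps)
  then show "is_quadratic (\<lambda>x. dot l x * dot m x)" unfolding is_quadratic_def by blast
  show "\<exists>x. dot l x * dot m x \<noteq> 0"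
  proof (rule ccontr)
    assume "\<nexists>x. dot l x * dot m x \<noteq> 0"
    then have "quadratic_form (l$1*m$1) (l$2*m$2) (l$3*m$3)
      (l$1*m$2 + l$2*m$1) (l$1*m$3 + l$3*m$1) (l$2*m$3 + l$3*m$2) x = 0" for x
      by (metis *)
    from quadratic_form_zero_coefficients[OF this] show False
      using assms by (auto simp: vec3_eq_iff)
  qed
qed

text \<open>Two zeros of \<open>Q\<close> that are conjugate, that is, with vanishing polar value, span a line of zeros.\<close>

lemma vanishes_on_line:
  assumes Q: "is_quadratic Q" and "l \<noteq> 0" "cross x y \<noteq> 0" "dot l x = 0" "dot l y = 0"
    "Q x = 0" "Q y = 0" "polar Q x y = 0" "dot l z = 0"
  shows "Q z = 0"
proof -
  obtain a b where "z = a *s x + b *s y" using on_line_combination assms by blast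
  then show ?thesis using quadratic_combination[OF Q] assms by simp
qed

text \<open>The key lemma: a conic that contains a line and a triangle disjoint from it does not exist.
  The line joining two vertices \<open>u\<close>, \<open>v\<close> meets the given line in a third zero,
  \<open>dot l v *s u - dot l u *s v\<close>, so \<open>u\<close> and \<open>v\<close> are conjugate. In the basis formed by the
  triangle all coefficients of \<open>Q\<close> are then zero. This takes the place of factoring a reducible
  form into linear forms.\<close>

lemma vanishes_on_line_and_triangle:
  assumes Q: "is_quadratic Q" and line: "\<And>z. dot l z = 0 \<Longrightarrow> Q z = 0"
    and off: "dot l a \<noteq> 0" "dot l b \<noteq> 0" "dot l c \<noteq> 0"
    and zero: "Q a = 0" "Q b = 0" "Q c = 0" and indep: "dot (cross a b) c \<noteq> 0"
  shows "Q x = 0"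
proof -
  have *: "polar Q u v = 0" if "dot l u \<noteq> 0" "dot l v \<noteq> 0" "Q u = 0" "Q v = 0" for u v
  proof -
    have "Q (dot l v *s u + (- dot l u) *s v) = 0"
      by (rule line) simp
    then show ?thesis using that unfolding quadratic_combination[OF Q] by simp
  qed
  obtain \<alpha> \<beta> \<gamma> where "x = \<alpha> *s a + \<beta> *s b + \<gamma> *s c" using cramer[OF indep] by blast
  then show ?thesis using quadratic_combination3[OF Q] * off zero by simp
qed

section \<open>Points, lines and their cardinalities\<close>

definition rep :: "('a::field ^ 3) set \<Rightarrow> 'a ^ 3" where
  "rep P = (SOME v. v \<noteq> 0 \<and> P = vec.span {v})"

lemma rep:
  assumes "P \<in> proj_plane"
  shows "rep P \<noteq> 0" "vec.span {rep P} = P"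
proof -
  have "\<exists>v. v \<noteq> 0 \<and> P = vec.span {v}" using assms by (auto simp: proj_plane_def)
  from someI_ex[OF this] show "rep P \<noteq> 0" "vec.span {rep P} = P" by (simp_all add: rep_def)
qed

lemma distinct_points_cross:
  assumes "P \<in> proj_plane" "R \<in> proj_plane" "P \<noteq> R"
  shows "cross (rep P) (rep R) \<noteq> 0"
  using cross_zero_span[of "rep P" "rep R"] rep assms by metis

lemma zero_set_iff:
  assumes "\<And>c x. F x = 0 \<Longrightarrow> F (c *s x) = 0"
  shows "P \<in> zero_set F \<longleftrightarrow> P \<in> proj_plane \<and> F (rep P) = 0"
proof (cases "P \<in> proj_plane")
  case True
  then have "P = range (\<lambda>c. c *s rep P)" using rep(2) vec.span_singleton by metis
  then have "(\<forall>x\<in>P. F x = 0) \<longleftrightarrow> (\<forall>c. F (c *s rep P) = 0)" by (metis rangeE rangeI)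
  also have "\<dots> \<longleftrightarrow> F (rep P) = 0" using assms by (metis vector_smult_lid)
  finally show ?thesis using True by (simp add: zero_set_def)
qed (simp add: zero_set_def)

lemma zero_set_dot: "P \<in> zero_set (dot l) \<longleftrightarrow> P \<in> proj_plane \<and> dot l (rep P) = 0"
  by (rule zero_set_iff) simp

lemma zero_set_quadratic:
  "is_quadratic Q \<Longrightarrow> P \<in> zero_set Q \<longleftrightarrow> P \<in> proj_plane \<and> Q (rep P) = 0"
  by (rule zero_set_iff) (simp add: quadratic_scale)

lemma card_insert_range_le:
  fixes f :: "'b::finite \<Rightarrow> 'c"
  assumes "A \<subseteq> insert p (range f)"
  shows "card A \<le> CARD('b) + 1"
proof -
  have "card A \<le> card (insert p (range f))" by (rule card_mono) (use assms in auto)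
  also have "\<dots> \<le> Suc (card (range f))" by (rule card_insert_le_m1) auto
  also have "\<dots> \<le> CARD('b) + 1" by (simp add: card_image_le)
  finally show ?thesis .
qed

text \<open>Each of the \<open>q ^ 3 - 1\<close> nonzero vectors lies in a point, and a point contains at most
  \<open>q - 1\<close> of them.\<close>

lemma card_proj_plane:
  "CARD('a)\<^sup>2 + CARD('a) + 1 \<le> card (proj_plane :: ('a::{field,finite} ^ 3) set set)"
proof -
  let ?q = "CARD('a)" and ?P = "proj_plane :: ('a ^ 3) set set"
  have q: "1 < ?q"
    using card_mono[of UNIV "{0, 1 :: 'a}"] by simp
  have *: "card (P - {0}) \<le> ?q - 1" if "P \<in> ?P" for P
  proof -
    have "P = range (\<lambda>c. c *s rep P)" using that rep(2) vec.span_singleton by metis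
    have "P - {0} \<subseteq> (\<lambda>c. c *s rep P) ` (UNIV - {0})"
    proof
      fix v assume v: "v \<in> P - {0}"
      with \<open>P = _\<close> obtain c where "v = c *s rep P" by blast
      with v show "v \<in> (\<lambda>c. c *s rep P) ` (UNIV - {0})" by (cases "c = 0") auto
    qed
    then have "card (P - {0}) \<le> card (UNIV - {0 :: 'a})" by (rule surj_card_le[rotated]) simp
    then show ?thesis by (simp add: card_Diff_singleton)
  qed
  have "v \<in> vec.span {v}" for v :: "'a ^ 3" by (simp add: vec.span_base)
  then have "UNIV - {0} \<subseteq> (\<Union>P\<in>?P. P - {0})"
    unfolding proj_plane_def by blast
  then have "card (UNIV - {0 :: 'a ^ 3}) \<le> card (\<Union>P\<in>?P. P - {0})" by (rule card_mono[rotated]) simp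
  also have "\<dots> \<le> (\<Sum>P\<in>?P. card (P - {0}))" by (rule card_UN_le) simp
  also have "\<dots> \<le> (\<Sum>P\<in>?P. ?q - 1)" by (rule sum_mono) (rule *)
  finally have "?q ^ 3 - 1 \<le> card ?P * (?q - 1)" by (simp add: card_Diff_singleton)
  moreover have "?q ^ 3 - 1 = (?q\<^sup>2 + ?q + 1) * (?q - 1)"
    using q by (auto simp: algebra_simps power2_eq_square power3_eq_cube diff_mult_distrib2 less_iff_Suc_add)
  ultimately have "(?q\<^sup>2 + ?q + 1) * (?q - 1) \<le> card ?P * (?q - 1)" by (simp only:)
  then show ?thesis using q unfolding mult_le_cancel2 by simp
qed

lemma card_line_le:
  fixes l :: "'a::{field,finite} ^ 3"
  assumes "l \<noteq> 0"
  shows "card (zero_set (dot l)) \<le> CARD('a) + 1"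
proof -
  obtain r where "cross l r \<noteq> 0" using independent_in_kernel[of l 0] assms by (auto simp: dot_def)
  then obtain w where w: "dot l w = 0" "cross (cross l r) w \<noteq> 0"
    using independent_in_kernel[of "cross l r" l] by auto
  define u where "u = cross l r"
  have "zero_set (dot l) \<subseteq> insert (vec.span {u}) (range (\<lambda>t. vec.span {t *s u + w}))"
  proof
    fix P assume P: "P \<in> zero_set (dot l)"
    then have Pp: "P \<in> proj_plane" and "dot l (rep P) = 0" by (auto simp: zero_set_dot)
    then obtain a b where ab: "rep P = a *s u + b *s w"
      using on_line_combination[of u w l "rep P"] w assms by (auto simp: u_def)
    show "P \<in> insert (vec.span {u}) (range (\<lambda>t. vec.span {t *s u + w}))"
    proof (cases "b = 0")
      case True
      then have "a \<noteq> 0" using ab rep(1)[OF Pp] by auto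
      with True ab have "P = vec.span {u}" using span_scale rep(2)[OF Pp] by fastforce
      then show ?thesis by simp
    next
      case False
      then have "rep P = b *s ((a / b) *s u + w)" using ab by (simp add: vector_add_ldistrib)
      then have "P = vec.span {(a / b) *s u + w}" using span_scale[OF False] rep(2)[OF Pp] by metis
      then show ?thesis by blast
    qed
  qed
  then show ?thesis by (rule card_insert_range_le)
qed

lemma lines_meet:
  assumes "l \<noteq> 0" "m \<noteq> 0" "zero_set (dot l) \<noteq> zero_set (dot m)"
  shows "zero_set (dot l) \<inter> zero_set (dot m) \<noteq> {}"
proof -
  have "cross l m \<noteq> 0"
  proof
    assume "cross l m = 0"
    then have "vec.span {l} = vec.span {m}" using cross_zero_span assms by blast
    then have "l \<in> range (\<lambda>k. k *s m)" by (metis vec.span_base singletonI vec.span_singleton)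
    then obtain k where k: "l = k *s m" by blast
    then have "dot l x = k * dot m x" for x by (simp add: dot_def algebra_simps)
    moreover have "k \<noteq> 0" using k assms by auto
    ultimately have "zero_set (dot l) = zero_set (dot m)" by (auto simp: zero_set_def)
    with assms show False by blast
  qed
  let ?P = "vec.span {cross l m}"
  have "?P \<in> proj_plane" using \<open>cross l m \<noteq> 0\<close> by (auto simp: proj_plane_def)
  then have "?P \<in> zero_set (dot l) \<inter> zero_set (dot m)"
    by (auto simp: zero_set_def vec.span_singleton)
  then show ?thesis by blast
qed

text \<open>Two distinct lines meet, so one of the at most \<open>q + 1\<close> points is lost.\<close>

lemma card_line_minus_line_le:
  fixes l m :: "'a::{field,finite} ^ 3"
  assumes "l \<noteq> 0" "m \<noteq> 0"
  shows "card (zero_set (dot l) - zero_set (dot m)) \<le> CARD('a)"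
proof (cases "zero_set (dot l) = zero_set (dot m)")
  case False
  then obtain P where "P \<in> zero_set (dot l)" "P \<in> zero_set (dot m)" using lines_meet assms by blast
  then have "zero_set (dot l) - zero_set (dot m) \<subset> zero_set (dot l)" by blast
  then have "card (zero_set (dot l) - zero_set (dot m)) < card (zero_set (dot l))"
    by (rule psubset_card_mono[rotated]) simp
  then show ?thesis using card_line_le[OF assms(1)] by linarith
qed simp

text \<open>A conic without lines is projected from one of its points \<open>p\<close>. Choose a tangent direction
  \<open>r\<close>, conjugate to \<open>p\<close>: the line joining \<open>p\<close> and \<open>r\<close> contains no other point of the conic,
  for such a point would make the whole line part of it. The other lines through \<open>p\<close> have
  directions \<open>t *s r + s\<close>, one for each scalar \<open>t\<close>, and each carries at most one further point,
  obtained by solving a linear equation. This gives the bound \<open>q + 1\<close>.\<close>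

lemma card_conic_le:
  fixes Q :: "'a::{field,finite} ^ 3 \<Rightarrow> 'a"
  assumes Q: "is_quadratic Q" and noline: "\<And>l. l \<noteq> 0 \<Longrightarrow> \<exists>x. dot l x = 0 \<and> Q x \<noteq> 0"
  shows "card (zero_set Q) \<le> CARD('a) + 1"
proof (cases "zero_set Q = {}")
  case False
  then obtain P0 where P0: "P0 \<in> zero_set Q" by blast
  define p where "p = rep P0"
  have p: "p \<noteq> 0" "Q p = 0" using P0 rep(1) by (auto simp: p_def zero_set_quadratic[OF Q])
  \<comment> \<open>A direction at a point of the conic cannot be both conjugate to it and a zero of the form.\<close>
  have secant: "polar Q p d \<noteq> 0 \<or> Q d \<noteq> 0" if d: "cross p d \<noteq> 0" for d
  proof (rule ccontr)
    assume "\<not> ?thesis"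
    then have "Q z = 0" if "dot (cross p d) z = 0" for z
      using vanishes_on_line[OF Q d d dot_cross(1,2)] p that by blast
    then show False using noline[OF d] by blast
  qed
  obtain m where m: "\<And>y. polar Q p y = dot m y" using polar_linear[OF Q] by blast
  have "dot m p = 0" using m[of p] polar_self[OF Q] p by simp
  then obtain r where r: "dot m r = 0" "cross p r \<noteq> 0" using independent_in_kernel p by blast
  obtain s where s: "dot (cross p r) s \<noteq> 0" using dot_nonzero[OF r(2)] by blast
  \<comment> \<open>The second intersection of the conic with the line through p in direction t *s r + s.\<close>
  define f where "f t = vec.span {(- Q (t *s r + s) / polar Q p s) *s p + (t *s r + s)}" for t
  have "zero_set Q \<subseteq> insert (vec.span {p}) (range f)"
  proof
    fix P assume "P \<in> zero_set Q"
    then have P: "P \<in> proj_plane" "Q (rep P) = 0" by (auto simp: zero_set_quadratic[OF Q])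
    obtain a b c where abc: "rep P = a *s p + b *s r + c *s s" using cramer[OF s] by blast
    show "P \<in> insert (vec.span {p}) (range f)"
    proof (cases "c = 0")
      case True
      have "b\<^sup>2 * Q r = 0"
        using P(2) abc True p r m quadratic_combination[OF Q, of a p b r] by simp
      moreover have "Q r \<noteq> 0" using secant[OF r(2)] m r(1) by simp
      ultimately have "b = 0" by simp
      then have "rep P = a *s p" using abc True by simp
      then have "P = vec.span {p}" using span_scale[of a p] rep[OF P(1)] by force
      then show ?thesis by blast
    next
      case False
      define d where "d = (b / c) *s r + s"
      have d: "rep P = c *s ((a / c) *s p + d)"
        using False abc by (simp add: d_def vector_add_ldistrib)
      have "dot (cross p d) r \<noteq> 0"
      proof -
        have "dot (cross p d) r = - dot (cross p r) s"
          by (simp add: d_def dot_def algebra_simps)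
        then show ?thesis using s by simp
      qed
      then have "cross p d \<noteq> 0" using dot_linear(5) by metis
      then have "polar Q p d \<noteq> 0 \<or> Q d \<noteq> 0" by (rule secant)
      moreover have "polar Q p d = polar Q p s" by (simp add: m d_def r)
      moreover have "Q ((a / c) *s p + d) = 0"
        using P(2) False unfolding d quadratic_scale[OF Q] by simp
      then have *: "(a / c) * polar Q p d + Q d = 0"
        using quadratic_combination[OF Q, of "a / c" p 1 d] p by (simp add: algebra_simps)
      ultimately have "polar Q p s \<noteq> 0" by auto
      moreover have "(a / c) * polar Q p s = - Q d"
        using * unfolding \<open>polar Q p d = polar Q p s\<close> by (simp only: eq_neg_iff_add_eq_0)
      ultimately have "a / c = - Q d / polar Q p s" using nonzero_eq_divide_eq by blast
      then have "f (b / c) = vec.span {(a / c) *s p + d}" by (simp add: f_def d_def)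
      also have "\<dots> = P" using span_scale[OF False] d rep(2)[OF P(1)] by metis
      finally show ?thesis by blast
    qed
  qed
  then show ?thesis by (rule card_insert_range_le)
qed simp

section \<open>Conics through five points\<close>

text \<open>The union of all conics through \<open>S\<close>. For five points it replaces the conic through them and
  is meaningful before uniqueness is known.\<close>

definition conic_closure :: "('a::field ^ 3) set set \<Rightarrow> ('a ^ 3) set set" where
  "conic_closure S = {P. \<exists>C. is_conic C \<and> insert P S \<subseteq> C}"

definition no_three_collinear :: "('a::field ^ 3) set set \<Rightarrow> bool" where
  "no_three_collinear S \<longleftrightarrow> (\<forall>l. l \<noteq> 0 \<longrightarrow> card (S \<inter> zero_set (dot l)) \<le> 2)"

lemma no_three_collinear_cross:
  assumes "no_three_collinear S" "finite S" "S \<subseteq> proj_plane" "a \<in> S" "b \<in> S" "c \<in> S"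
    and "a \<noteq> b" "a \<noteq> c" "b \<noteq> c"
  shows "dot (cross (rep a) (rep b)) (rep c) \<noteq> 0"
proof
  let ?l = "cross (rep a) (rep b)"
  assume "dot ?l (rep c) = 0"
  then have "{a, b, c} \<subseteq> S \<inter> zero_set (dot ?l)" using assms by (auto simp: zero_set_dot)
  then have "card {a, b, c} \<le> card (S \<inter> zero_set (dot ?l))"
    by (rule card_mono[rotated]) (use assms in simp)
  then have "2 < card (S \<inter> zero_set (dot ?l))" using assms by simp
  moreover have "?l \<noteq> 0" by (rule distinct_points_cross) (use assms in auto)
  ultimately show False using assms(1) by (auto simp: no_three_collinear_def not_le[symmetric])
qed

lemma obtain_three_distinct:
  assumes "3 \<le> card A"
  obtains a b c where "{a, b, c} \<subseteq> A" "a \<noteq> b" "a \<noteq> c" "b \<noteq> c"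
proof -
  obtain T where T: "T \<subseteq> A" "card T = 3" "finite T"
    by (rule obtain_subset_with_card_n[OF assms])
  then obtain a b c where "T = {a, b, c}" "a \<noteq> b" "a \<noteq> c" "b \<noteq> c"
    unfolding card_3_iff by (elim exE conjE)
  with T(1) show thesis using that by simp
qed

text \<open>Such a conic contains no line: three of the five points would form a triangle off the line.\<close>

lemma no_three_collinear_vanish:
  assumes Q: "is_quadratic Q" and S: "no_three_collinear S" "card S = 5" "S \<subseteq> zero_set Q"
    and l: "l \<noteq> 0" "\<And>z. dot l z = 0 \<Longrightarrow> Q z = 0"
  shows "Q x = 0"
proof -
  have fin: "finite S" using S(2) card.infinite by fastforce
  have pl: "S \<subseteq> proj_plane" and zero: "\<And>s. s \<in> S \<Longrightarrow> Q (rep s) = 0"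
    using S(3) by (auto simp: zero_set_quadratic[OF Q])
  have "card (S - zero_set (dot l)) = card S - card (S \<inter> zero_set (dot l))"
    using card_Diff_subset_Int[of S "zero_set (dot l)"] fin by simp
  then have "3 \<le> card (S - zero_set (dot l))"
    using S l(1) by (auto simp: no_three_collinear_def)
  then obtain a b c where abc: "{a, b, c} \<subseteq> S - zero_set (dot l)" "a \<noteq> b" "a \<noteq> c" "b \<noteq> c"
    by (rule obtain_three_distinct)
  then have "dot (cross (rep a) (rep b)) (rep c) \<noteq> 0"
    by (intro no_three_collinear_cross[OF S(1) fin pl]) auto
  then show ?thesis
    using abc pl zero l(2)
    by - (rule vanishes_on_line_and_triangle[OF Q, of l "rep a" "rep b" "rep c"], auto simp: zero_set_dot)
qed

lemma is_quadratic_diff: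
  assumes "is_quadratic Q" "is_quadratic Q'"
  shows "is_quadratic (\<lambda>x. c * Q x - d * Q' x)"
proof -
  obtain a1 a2 a3 a4 a5 a6 where Q: "Q = quadratic_form a1 a2 a3 a4 a5 a6"
    using assms is_quadratic_def by blast
  obtain b1 b2 b3 b4 b5 b6 where Q': "Q' = quadratic_form b1 b2 b3 b4 b5 b6"
    using assms is_quadratic_def by blast
  have "(\<lambda>x. c * Q x - d * Q' x) = quadratic_form (c*a1-d*b1) (c*a2-d*b2) (c*a3-d*b3)
      (c*a4-d*b4) (c*a5-d*b5) (c*a6-d*b6)"
    by (auto simp: Q Q' quadratic_form_def algebra_simps)
  then show ?thesis unfolding is_quadratic_def by blast
qed

text \<open>Five points, no three of them collinear, lie on at most one conic. Given two forms, take a third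
  point on the line joining two of the five points and combine the forms linearly so that the
  combination vanishes there too. It then has three zeros on the line, contains the line, and is
  zero, so the forms are proportional. The coefficients are the values at the third point; they are
  nonzero because neither form contains that line.\<close>

lemma conic_unique:
  assumes Q: "is_quadratic Q" "S \<subseteq> zero_set Q" "Q x \<noteq> 0"
    and Q': "is_quadratic Q'" "S \<subseteq> zero_set Q'" "Q' x' \<noteq> 0"
    and S: "no_three_collinear S" "card S = 5"
  shows "zero_set Q = zero_set Q'"
proof -
  have "\<not> card S \<le> Suc 0" "finite S" using S(2) card.infinite by (simp, fastforce)
  then obtain s t where st: "s \<in> S" "t \<in> S" "s \<noteq> t"
    using card_le_Suc0_iff_eq by blast
  have pl: "S \<subseteq> proj_plane" using Q by (auto simp: zero_set_def)
  let ?l = "cross (rep s) (rep t)" and ?r = "rep s + rep t"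
  have l: "?l \<noteq> 0" using distinct_points_cross st pl by blast
  \<comment> \<open>The sum of the representatives is the third point on the line.\<close>
  have nonzero: "F ?r \<noteq> 0" if F: "is_quadratic F" "S \<subseteq> zero_set F" "F y \<noteq> 0" for F y
  proof
    assume r: "F ?r = 0"
    have 0: "F (rep s) = 0" "F (rep t) = 0" using F st by (auto simp: zero_set_quadratic[OF F(1)])
    then have "polar F (rep s) (rep t) = 0" using r by (simp add: polar_def)
    then have "F z = 0" if "dot ?l z = 0" for z
      using vanishes_on_line[OF F(1) l l dot_cross(1,2)] 0 that by blast
    then have "F y = 0" using no_three_collinear_vanish[OF F(1) S F(2) l] by blast
    with F show False by blast
  qed
  define N where "N x = Q' ?r * Q x - Q ?r * Q' x" for x
  have N: "is_quadratic N" unfolding N_def by (rule is_quadratic_diff) fact+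
  have "Q (rep y) = 0" "Q' (rep y) = 0" if "y \<in> S" for y
    using Q(2) Q'(2) that zero_set_quadratic[OF Q(1)] zero_set_quadratic[OF Q'(1)] by blast+
  then have "N (rep y) = 0" if "y \<in> S" for y using that by (simp add: N_def)
  with pl have SN: "S \<subseteq> zero_set N" by (auto simp: zero_set_quadratic[OF N])
  have 0: "N (rep s) = 0" "N (rep t) = 0" using SN st by (auto simp: zero_set_quadratic[OF N])
  then have "polar N (rep s) (rep t) = 0" by (simp add: polar_def) (simp add: N_def)
  then have "N z = 0" if "dot ?l z = 0" for z
    using vanishes_on_line[OF N l l dot_cross(1,2)] 0 that by blast
  then have "N y = 0" for y using no_three_collinear_vanish[OF N S SN l] by blast
  then have "Q' ?r * Q y = Q ?r * Q' y" for y by (simp add: N_def)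
  then have "Q y = 0 \<longleftrightarrow> Q' y = 0" for y
    using nonzero[OF Q] nonzero[OF Q'] by (metis mult_eq_0_iff)
  then show ?thesis by (simp add: zero_set_def)
qed

text \<open>The conic is unique, irreducible, and has at most \<open>q + 1\<close> points, five of which are in \<open>S\<close>.\<close>

lemma card_conic_closure_arc:
  fixes S :: "('a::{field,finite} ^ 3) set set"
  assumes S: "no_three_collinear S" "card S = 5"
  shows "card (conic_closure S - S) \<le> CARD('a) - 4"
proof (cases "\<exists>C. is_conic C \<and> S \<subseteq> C")
  case False
  then have "conic_closure S = {}" by (auto simp: conic_closure_def)
  then show ?thesis by simp
next
  case True
  then obtain Q x where Q: "is_quadratic Q" "S \<subseteq> zero_set Q" "Q x \<noteq> 0"
    by (auto simp: is_conic_iff)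
  have sub: "conic_closure S \<subseteq> zero_set Q"
  proof
    fix P assume "P \<in> conic_closure S"
    then obtain Q' x' where Q': "is_quadratic Q'" "S \<subseteq> zero_set Q'" "Q' x' \<noteq> 0" "P \<in> zero_set Q'"
      by (auto simp: conic_closure_def is_conic_iff)
    then show "P \<in> zero_set Q" using conic_unique[OF Q Q'(1-3) S] by blast
  qed
  have "card (zero_set Q) \<le> CARD('a) + 1"
    using card_conic_le[OF Q(1)] no_three_collinear_vanish[OF Q(1) S Q(2)] Q(3) by blast
  moreover have "card (zero_set Q - S) = card (zero_set Q) - 5"
    using card_Diff_subset[of S "zero_set Q"] S Q(2) by simp
  moreover have "card (conic_closure S - S) \<le> card (zero_set Q - S)"
    by (rule card_mono) (use sub in auto)
  ultimately show ?thesis by linarith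
qed

text \<open>A line meeting a conic in three points is part of it: expressing the third point through the
  first two, both coefficients are nonzero, which makes the first two conjugate.\<close>

lemma vanishes_on_trisecant:
  assumes Q: "is_quadratic Q" and l: "l \<noteq> 0" and S: "3 \<le> card (zero_set Q \<inter> zero_set (dot l))"
    and z: "dot l z = 0"
  shows "Q z = 0"
proof -
  obtain a b c where abc: "{a, b, c} \<subseteq> zero_set Q \<inter> zero_set (dot l)"
    and neq: "a \<noteq> b" "a \<noteq> c" "b \<noteq> c"
    using S by (rule obtain_three_distinct)
  from abc have pl: "a \<in> proj_plane" "b \<in> proj_plane" "c \<in> proj_plane"
    and Q0: "Q (rep a) = 0" "Q (rep b) = 0" "Q (rep c) = 0"
    and l0: "dot l (rep a) = 0" "dot l (rep b) = 0" "dot l (rep c) = 0"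
    by (simp_all add: zero_set_dot zero_set_quadratic[OF Q])
  have ab: "cross (rep a) (rep b) \<noteq> 0" using distinct_points_cross pl neq by blast
  obtain \<alpha> \<beta> where c: "rep c = \<alpha> *s rep a + \<beta> *s rep b"
    using on_line_combination[OF ab l l0] by blast
  have "\<alpha> \<noteq> 0"
  proof
    assume "\<alpha> = 0"
    then have "cross (rep b) (rep c) = 0" using c by (simp add: vec3_eq_iff)
    then show False using distinct_points_cross pl neq by blast
  qed
  moreover have "\<beta> \<noteq> 0"
  proof
    assume "\<beta> = 0"
    then have "cross (rep a) (rep c) = 0" using c by (simp add: vec3_eq_iff)
    then show False using distinct_points_cross pl neq by blast
  qed
  ultimately have "polar Q (rep a) (rep b) = 0"
    using Q0(3) unfolding c quadratic_combination[OF Q] by (simp add: Q0)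
  then show ?thesis using vanishes_on_line[OF Q l ab] l0 Q0 z by blast
qed

text \<open>A conic through \<open>S\<close> contains the line \<open>l\<close>, being a trisecant. A further point outside both
  lines would form with \<open>a\<close> and \<open>b\<close> a triangle disjoint from \<open>l\<close>.\<close>

lemma conic_closure_two_lines:
  fixes S :: "('a::{field,finite} ^ 3) set set"
  assumes l: "l \<noteq> 0" "3 \<le> card (S \<inter> zero_set (dot l))"
    and ab: "a \<in> S" "b \<in> S" "a \<notin> zero_set (dot l)" "b \<notin> zero_set (dot l)"
  shows "conic_closure S \<subseteq> zero_set (dot l) \<union> zero_set (dot (cross (rep a) (rep b)))"
proof
  fix P assume "P \<in> conic_closure S"
  then obtain Q x where Q: "is_quadratic Q" "insert P S \<subseteq> zero_set Q" "Q x \<noteq> 0"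
    by (auto simp: conic_closure_def is_conic_iff)
  show "P \<in> zero_set (dot l) \<union> zero_set (dot (cross (rep a) (rep b)))"
  proof (rule ccontr)
    assume P: "\<not> ?thesis"
    have "Q z = 0" if "dot l z = 0" for z
    proof (rule vanishes_on_trisecant[OF Q(1) l(1) _ that])
      show "3 \<le> card (zero_set Q \<inter> zero_set (dot l))"
        using order_trans[OF l(2) card_mono[of "zero_set Q \<inter> zero_set (dot l)" "S \<inter> zero_set (dot l)"]]
          Q(2) by auto
    qed
    moreover have "P \<in> proj_plane" "a \<in> proj_plane" "b \<in> proj_plane"
      "Q (rep P) = 0" "Q (rep a) = 0" "Q (rep b) = 0"
      using Q(2) ab by (auto simp: zero_set_quadratic[OF Q(1)])
    ultimately have "Q x = 0"
      using P ab by - (rule vanishes_on_line_and_triangle[OF Q(1), of l "rep a" "rep b" "rep P"], auto simp: zero_set_dot)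
    with Q show False by blast
  qed
qed

section \<open>Lines and generalized arcs\<close>

text \<open>The product of two nonzero linear forms defines a conic.\<close>

lemma generalized_arc_two_lines:
  assumes K: "is_generalized_arc k K" and lm: "l \<noteq> 0" "m \<noteq> 0"
  shows "card (K \<inter> (zero_set (dot l) \<union> zero_set (dot m))) \<le> 5"
proof (rule ccontr)
  assume "\<not> ?thesis"
  then have "6 \<le> card (K \<inter> (zero_set (dot l) \<union> zero_set (dot m)))" by simp
  then obtain S where S: "S \<subseteq> K \<inter> (zero_set (dot l) \<union> zero_set (dot m))" "card S = 6" "finite S"
    by (rule obtain_subset_with_card_n)
  let ?Q = "\<lambda>x. dot l x * dot m x"
  note Q = product_of_linear_forms[OF lm]
  have "S \<subseteq> zero_set ?Q"
    using S by (auto simp: zero_set_quadratic[OF Q(1)] zero_set_dot)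
  moreover have "is_conic (zero_set ?Q)" using Q unfolding is_conic_iff by blast
  ultimately show False using K S unfolding is_generalized_arc_def by blast
qed

text \<open>Four points on a line and two more points, which exist because a generalized arc has at least
  six points, would lie on the conic formed by that line and the line joining the other two.\<close>

lemma generalized_arc_line:
  assumes K: "is_generalized_arc k K" and l: "l \<noteq> 0"
  shows "card (K \<inter> zero_set (dot l)) \<le> 3"
proof (rule ccontr)
  assume "\<not> ?thesis"
  then have "4 \<le> card (K \<inter> zero_set (dot l))" by simp
  then obtain A where A: "A \<subseteq> K \<inter> zero_set (dot l)" "card A = 4" "finite A"
    by (rule obtain_subset_with_card_n)
  have fin: "finite K" and pl: "K \<subseteq> proj_plane" and k: "6 \<le> card K"
    using K by (auto simp: is_generalized_arc_def)
  then have "2 \<le> card (K - A)" using A k card_Diff_subset[of A K] by auto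
  then obtain B where B: "B \<subseteq> K - A" "card B = 2" "finite B" by (rule obtain_subset_with_card_n)
  then obtain x y where xy: "B = {x, y}" "x \<noteq> y" by (auto simp: card_2_iff)
  let ?m = "cross (rep x) (rep y)"
  have xyp: "x \<in> proj_plane" "y \<in> proj_plane" using xy B pl by auto
  then have m: "?m \<noteq> 0" using distinct_points_cross xy by blast
  have "B \<subseteq> zero_set (dot ?m)" using xyp by (auto simp: xy zero_set_dot)
  then have "A \<union> B \<subseteq> K \<inter> (zero_set (dot l) \<union> zero_set (dot ?m))" using A B by blast
  then have "card (A \<union> B) \<le> 5"
    using generalized_arc_two_lines[OF K l m] card_mono[OF finite_Int] fin by (meson disjI1 order_trans)
  moreover have "card (A \<union> B) = card A + card B"
    by (rule card_Un_disjoint) (use A B in auto)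
  ultimately show False using A B by simp
qed

text \<open>Two disjoint collinear triples would be six points on a pair of lines.\<close>

lemma generalized_arc_disjoint_triple:
  assumes K: "is_generalized_arc k K" and l: "l \<noteq> 0" "card (K \<inter> zero_set (dot l)) = 3"
    and S: "S \<subseteq> K" "S \<inter> zero_set (dot l) = {}"
  shows "no_three_collinear S"
  unfolding no_three_collinear_def
proof (intro allI impI)
  fix m :: "'a ^ 3" assume m: "m \<noteq> 0"
  have fin: "finite K" using K by (auto simp: is_generalized_arc_def)
  have "card (K \<inter> zero_set (dot l)) + card (S \<inter> zero_set (dot m))
      = card ((K \<inter> zero_set (dot l)) \<union> (S \<inter> zero_set (dot m)))"
    by (rule card_Un_disjoint[symmetric]) (use S fin in \<open>auto intro: finite_subset\<close>)
  also have "\<dots> \<le> card (K \<inter> (zero_set (dot l) \<union> zero_set (dot m)))"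
    by (rule card_mono) (use S fin in auto)
  also have "\<dots> \<le> 5" by (rule generalized_arc_two_lines[OF K l(1) m])
  finally show "card (S \<inter> zero_set (dot m)) \<le> 2" using l by simp
qed

lemma conic_closure_trisecant:
  fixes S :: "('a::{field,finite} ^ 3) set set"
  assumes l: "l \<noteq> 0" "card (S \<inter> zero_set (dot l)) = 3" and S: "card S = 5" "S \<subseteq> proj_plane"
  obtains m where "m \<noteq> 0" "S \<subseteq> zero_set (dot l) \<union> zero_set (dot m)"
    "conic_closure S \<subseteq> zero_set (dot l) \<union> zero_set (dot m)"
proof -
  have "card (S - zero_set (dot l)) = 2"
    using card_Diff_subset_Int[of S "zero_set (dot l)"] l S by simp
  then obtain a b where ab: "S - zero_set (dot l) = {a, b}" "a \<noteq> b" by (auto simp: card_2_iff)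
  let ?m = "cross (rep a) (rep b)"
  have abS: "a \<in> S" "b \<in> S" "a \<notin> zero_set (dot l)" "b \<notin> zero_set (dot l)" using ab by blast+
  then have abp: "a \<in> proj_plane" "b \<in> proj_plane" using S by auto
  then have "?m \<noteq> 0" using distinct_points_cross ab by blast
  moreover have "{a, b} \<subseteq> zero_set (dot ?m)" using abp by (auto simp: zero_set_dot)
  then have "S \<subseteq> zero_set (dot l) \<union> zero_set (dot ?m)" using ab by blast
  moreover have "conic_closure S \<subseteq> zero_set (dot l) \<union> zero_set (dot ?m)"
    using conic_closure_two_lines[OF l(1) _ abS] l by simp
  ultimately show thesis by (rule that)
qed

text \<open>The extreme case is a pair of lines, which has \<open>2 * q + 1\<close> points, five of them in \<open>S\<close>.\<close>

lemma card_conic_closure_le: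
  fixes K :: "('a::{field,finite} ^ 3) set set"
  assumes K: "is_generalized_arc k K" and S: "S \<subseteq> K" "card S = 5" and q: "4 \<le> CARD('a)"
  shows "card (conic_closure S - S) \<le> 2 * CARD('a) - 4"
proof (cases "no_three_collinear S")
  case True
  then show ?thesis using card_conic_closure_arc[OF True S(2)] q by linarith
next
  case False
  then obtain l where l: "l \<noteq> 0" "3 \<le> card (S \<inter> zero_set (dot l))"
    by (auto simp: no_three_collinear_def not_le)
  have "card (S \<inter> zero_set (dot l)) \<le> card (K \<inter> zero_set (dot l))"
    by (rule card_mono) (use S in auto)
  then have "card (S \<inter> zero_set (dot l)) = 3"
    using l generalized_arc_line[OF K l(1)] by simp
  moreover have "S \<subseteq> proj_plane" using S K by (auto simp: is_generalized_arc_def)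
  ultimately obtain m where m: "m \<noteq> 0" "S \<subseteq> zero_set (dot l) \<union> zero_set (dot m)"
    "conic_closure S \<subseteq> zero_set (dot l) \<union> zero_set (dot m)"
    using conic_closure_trisecant[OF l(1)] S by blast
  let ?U = "zero_set (dot l) \<union> zero_set (dot m)"
  have "?U = zero_set (dot l) \<union> (zero_set (dot m) - zero_set (dot l))" by blast
  then have "card ?U \<le> card (zero_set (dot l)) + card (zero_set (dot m) - zero_set (dot l))"
    using card_Un_le by metis
  also have "\<dots> \<le> (CARD('a) + 1) + CARD('a)"
    by (intro add_mono card_line_le card_line_minus_line_le l m)
  finally have "card (?U - S) \<le> 2 * CARD('a) - 4"
    using card_Diff_subset[of S ?U] m(2) S(2) by simp
  moreover have "card (conic_closure S - S) \<le> card (?U - S)"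
    by (rule card_mono) (use m in auto)
  ultimately show ?thesis by linarith
qed

text \<open>Outside the trisecant only the second line remains. It loses its point on the trisecant and the
  two points of \<open>S\<close> that determine it.\<close>

lemma card_conic_closure_off_trisecant:
  fixes S :: "('a::{field,finite} ^ 3) set set"
  assumes l: "l \<noteq> 0" "card (S \<inter> zero_set (dot l)) = 3" and S: "card S = 5" "S \<subseteq> proj_plane"
  shows "card (conic_closure S - zero_set (dot l) - S) \<le> CARD('a) - 2"
proof -
  obtain m where m: "m \<noteq> 0" "S \<subseteq> zero_set (dot l) \<union> zero_set (dot m)"
    "conic_closure S \<subseteq> zero_set (dot l) \<union> zero_set (dot m)"
    using conic_closure_trisecant[OF l S] by blast
  let ?M = "zero_set (dot m) - zero_set (dot l)" and ?B = "S - zero_set (dot l)"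
  have "card ?B = 2" using card_Diff_subset_Int[of S "zero_set (dot l)"] l S by simp
  have "card (conic_closure S - zero_set (dot l) - S) \<le> card (?M - ?B)"
    by (rule card_mono) (use m in auto)
  also have "\<dots> = card ?M - card ?B" by (rule card_Diff_subset) (use m in auto)
  also have "\<dots> \<le> CARD('a) - 2"
    using card_line_minus_line_le[OF m(1) l(1)] \<open>card ?B = 2\<close> by simp
  finally show ?thesis .
qed

section \<open>Counting the points covered by a complete generalized arc\<close>

text \<open>By completeness, \<open>insert P K\<close> contains six points of a conic. One of them is \<open>P\<close>, because
  \<open>K\<close> contains no six points of a conic.\<close>

lemma complete_arc_covers:
  assumes K: "is_complete_generalized_arc k K" and P: "P \<in> proj_plane - K"
  shows "\<exists>S. S \<subseteq> K \<and> card S = 5 \<and> P \<in> conic_closure S"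
proof -
  have arc: "is_generalized_arc k K" using K by (simp add: is_complete_generalized_arc_def)
  have "\<not> is_generalized_arc (k + 1) (insert P K)"
    using K by (auto simp: is_complete_generalized_arc_def)
  then obtain S C where SC: "S \<subseteq> insert P K" "card S = 6" "is_conic C" "S \<subseteq> C"
    using arc P by (auto simp: is_generalized_arc_def)
  have "P \<in> S"
  proof (rule ccontr)
    assume "P \<notin> S"
    then have "S \<subseteq> K" using SC by blast
    with SC arc show False by (auto simp: is_generalized_arc_def)
  qed
  moreover have "finite S" using SC(2) card.infinite by fastforce
  ultimately have "card (S - {P}) = 5" using SC by simp
  moreover have "S - {P} \<subseteq> K" using SC by blast
  moreover have "P \<in> conic_closure (S - {P})"
    using SC \<open>P \<in> S\<close> by (auto simp: conic_closure_def)
  ultimately show ?thesis by blast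
qed

lemma card_UN_le_mult:
  assumes "finite F" "\<And>S. S \<in> F \<Longrightarrow> card (g S) \<le> b" "card F \<le> n"
  shows "card (\<Union>S\<in>F. g S) \<le> n * b"
proof -
  have "card (\<Union>S\<in>F. g S) \<le> (\<Sum>S\<in>F. card (g S))" by (rule card_UN_le) fact
  also have "\<dots> \<le> of_nat (card F) * b" by (rule sum_bounded_above) (rule assms)
  also have "\<dots> \<le> n * b" using assms by simp
  finally show ?thesis .
qed

lemma card_subsets_meeting_le:
  assumes "finite K"
  shows "card {S. S \<subseteq> K \<and> card S = n \<and> card (S \<inter> L) = i}
    \<le> (card (K \<inter> L) choose i) * (card (K - L) choose (n - i))"
proof -
  let ?A = "{A. A \<subseteq> K \<inter> L \<and> card A = i}" and ?B = "{B. B \<subseteq> K - L \<and> card B = n - i}"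
  have "{S. S \<subseteq> K \<and> card S = n \<and> card (S \<inter> L) = i} \<subseteq> (\<lambda>(A, B). A \<union> B) ` (?A \<times> ?B)"
  proof
    fix S assume S: "S \<in> {S. S \<subseteq> K \<and> card S = n \<and> card (S \<inter> L) = i}"
    then have "finite S" using assms finite_subset by blast
    then have "card (S - L) = n - i" using S card_Diff_subset_Int[of S L] by simp
    then have "(S \<inter> L, S - L) \<in> ?A \<times> ?B" using S by blast
    moreover have "S = (\<lambda>(A, B). A \<union> B) (S \<inter> L, S - L)" by auto
    ultimately show "S \<in> (\<lambda>(A, B). A \<union> B) ` (?A \<times> ?B)" by (rule rev_image_eqI)
  qed
  then have "card {S. S \<subseteq> K \<and> card S = n \<and> card (S \<inter> L) = i} \<le> card (?A \<times> ?B)"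
    by (rule surj_card_le[rotated]) (use assms in auto)
  moreover have "card ?A = card (K \<inter> L) choose i" "card ?B = card (K - L) choose (n - i)"
    by (rule n_subsets; use assms in simp)+
  ultimately show ?thesis by (simp only: card_cartesian_product)
qed

lemma complete_arc_bound:
  fixes K :: "('a::{field,finite} ^ 3) set set"
  assumes K: "is_complete_generalized_arc k K" and arc: "is_arc k K"
  shows "CARD('a)\<^sup>2 + CARD('a) + 1 \<le> (k choose 5) * (CARD('a) - 4) + k"
proof -
  let ?P = "proj_plane :: ('a ^ 3) set set" and ?F = "{S. S \<subseteq> K \<and> card S = 5}"
  have fin: "finite K" and k: "card K = k" and pl: "K \<subseteq> ?P" using arc by (auto simp: is_arc_def)
  have "no_three_collinear S" if "S \<subseteq> K" for S
    unfolding no_three_collinear_def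
  proof (intro allI impI, rule ccontr)
    fix l :: "'a ^ 3" assume l: "l \<noteq> 0" and "\<not> card (S \<inter> zero_set (dot l)) \<le> 2"
    then have "3 \<le> card (S \<inter> zero_set (dot l))" by simp
    then obtain T where "T \<subseteq> S \<inter> zero_set (dot l)" "card T = 3" "finite T"
      by (rule obtain_subset_with_card_n)
    moreover have "is_line (zero_set (dot l))" using l is_line_iff by blast
    ultimately show False using arc that unfolding is_arc_def by blast
  qed
  then have "card (\<Union>S\<in>?F. conic_closure S - S) \<le> (k choose 5) * (CARD('a) - 4)"
    by (intro card_UN_le_mult card_conic_closure_arc) (use fin k in \<open>auto simp: n_subsets\<close>)
  moreover have "?P \<subseteq> (\<Union>S\<in>?F. conic_closure S - S) \<union> K"
    using complete_arc_covers[OF K] by blast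
  then have "card ?P \<le> card ((\<Union>S\<in>?F. conic_closure S - S) \<union> K)" by (rule card_mono[rotated]) simp
  then have "card ?P \<le> card (\<Union>S\<in>?F. conic_closure S - S) + k" using card_Un_le[of "\<Union>S\<in>?F. conic_closure S - S" K] k by linarith
  ultimately show ?thesis using card_proj_plane[where 'a='a] by linarith
qed

text \<open>Count the points off a trisecant \<open>L\<close>; there are at least \<open>q\<^sup>2\<close> of them and
  \<open>k - 3\<close> belong to \<open>K\<close>. The others are covered by conics through five-point subsets \<open>S\<close> of
  \<open>K\<close>, which are sorted by \<open>i = card (S \<inter> L)\<close>. If \<open>i = 0\<close>, no three points of \<open>S\<close> are
  collinear and at most \<open>q - 4\<close> points are new. If \<open>i = 3\<close>, the conic is \<open>L\<close> and another line,
  which contributes at most \<open>q - 2\<close>. If \<open>i\<close> is 1 or 2, the bound for a pair of lines,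
  \<open>2 * q - 4\<close>, is used; the number of these sets is at most
  \<open>3 * (k - 3 choose 4) + 3 * (k - 3 choose 3) = 3 * (k - 2 choose 4)\<close>, which explains the
  coefficient \<open>6 * q - 12\<close>.\<close>

lemma complete_nonarc_bound:
  fixes K :: "('a::{field,finite} ^ 3) set set"
  assumes K: "is_complete_generalized_arc k K" and nonarc: "\<not> is_arc k K" and q: "4 \<le> CARD('a)"
  shows "CARD('a)\<^sup>2 + 3 \<le> ((k - 3) choose 5) * (CARD('a) - 4)
    + ((k - 2) choose 4) * (6 * CARD('a) - 12) + ((k - 3) choose 2) * (CARD('a) - 2) + k"
proof -
  let ?P = "proj_plane :: ('a ^ 3) set set" and ?q = "CARD('a)"
  have arc: "is_generalized_arc k K" using K by (simp add: is_complete_generalized_arc_def)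
  then have fin: "finite K" and k: "card K = k" "6 \<le> k" and pl: "K \<subseteq> ?P"
    by (auto simp: is_generalized_arc_def)
  obtain T l where T: "T \<subseteq> K" "card T = 3" "l \<noteq> 0" "T \<subseteq> zero_set (dot l)"
    using nonarc fin k pl by (auto simp: is_arc_def is_line_iff)
  define L where "L = zero_set (dot l)"
  have "card T \<le> card (K \<inter> L)" by (rule card_mono) (use T L_def in auto)
  then have KL: "card (K \<inter> L) = 3" using generalized_arc_line[OF arc T(3)] T(2) by (simp add: L_def)
  have KmL: "card (K - L) = k - 3" using card_Diff_subset_Int[of K L] fin k KL by simp
  define fam where "fam i = {S. S \<subseteq> K \<and> card S = 5 \<and> card (S \<inter> L) = i}" for i
  define new where "new S = conic_closure S - L - K" for S
  have card_fam: "card (fam i) \<le> (3 choose i) * ((k - 3) choose (5 - i))" for i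
    using card_subsets_meeting_le[OF fin, of 5 L i] KL KmL by (simp add: fam_def)
  have new_le: "card (new S) \<le> card (conic_closure S - S)" if "S \<in> fam i" for S i
    by (rule card_mono) (use that in \<open>auto simp: new_def fam_def\<close>)
  have b0: "card (new S) \<le> ?q - 4" if S: "S \<in> fam 0" for S
  proof -
    have "no_three_collinear S"
      by (rule generalized_arc_disjoint_triple[OF arc T(3)])
       (use S KL in \<open>auto simp: fam_def L_def\<close>)
    from card_conic_closure_arc[OF this] S new_le[OF S] show ?thesis by (simp add: fam_def)
  qed
  have b12: "card (new S) \<le> 2 * ?q - 4" if S: "S \<in> fam i" for S i
    using card_conic_closure_le[OF arc _ _ q, of S] new_le[OF S] S by (simp add: fam_def)
  have b3: "card (new S) \<le> ?q - 2" if S: "S \<in> fam 3" for S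
  proof -
    have "card (new S) \<le> card (conic_closure S - zero_set (dot l) - S)"
      by (rule card_mono) (use S in \<open>auto simp: new_def fam_def L_def\<close>)
    moreover have "S \<subseteq> proj_plane" using S pl by (auto simp: fam_def)
    ultimately show ?thesis
      using card_conic_closure_off_trisecant[OF T(3), of S] S by (simp add: fam_def L_def)
  qed
  define N where "N i = (\<Union>S\<in>fam i. new S)" for i
  have N: "card (N 0) \<le> ((k - 3) choose 5) * (?q - 4)"
    "card (N 1) \<le> (3 * ((k - 3) choose 4)) * (2 * ?q - 4)"
    "card (N 2) \<le> (3 * ((k - 3) choose 3)) * (2 * ?q - 4)"
    "card (N 3) \<le> ((k - 3) choose 2) * (?q - 2)"
    unfolding N_def
    using card_fam[of 0] card_fam[of 1] card_fam[of 2] card_fam[of 3] b0 b12 b3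
    by (intro card_UN_le_mult; simp add: numeral_eq_Suc)+
  have "?P - L \<subseteq> (K - L) \<union> (N 0 \<union> N 1 \<union> N 2 \<union> N 3)"
  proof
    fix P assume P: "P \<in> ?P - L"
    show "P \<in> (K - L) \<union> (N 0 \<union> N 1 \<union> N 2 \<union> N 3)"
    proof (cases "P \<in> K")
      case False
      then obtain S where S: "S \<subseteq> K" "card S = 5" "P \<in> conic_closure S"
        using complete_arc_covers[OF K, of P] P by blast
      have "card (S \<inter> L) \<le> card (K \<inter> L)" by (rule card_mono) (use S in auto)
      then have "card (S \<inter> L) \<le> 3" using KL by simp
      moreover have "i \<in> {0, 1, 2, 3}" if "i \<le> 3" for i :: nat using that by auto
      ultimately have "card (S \<inter> L) \<in> {0, 1, 2, 3}" by blast
      moreover have "P \<in> N (card (S \<inter> L))"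
        using S P False by (auto simp: N_def fam_def new_def)
      ultimately show ?thesis by auto
    qed (use P in blast)
  qed
  then have "card (?P - L) \<le> card ((K - L) \<union> (N 0 \<union> N 1 \<union> N 2 \<union> N 3))"
    by (rule card_mono[rotated]) simp
  also have "\<dots> \<le> card (K - L) + (card (N 0) + card (N 1) + card (N 2) + card (N 3))"
    by (intro order_trans[OF card_Un_le] add_mono order_refl)
  finally have "card (?P - L) \<le> card (K - L) + (card (N 0) + card (N 1) + card (N 2) + card (N 3))" .
  moreover have "?q\<^sup>2 \<le> card (?P - L)"
    using card_proj_plane[where 'a='a] card_line_le[OF T(3)]
      diff_card_le_card_Diff[of L ?P] by (simp add: L_def)
  moreover have "(k - 2) choose 4 = ((k - 3) choose 4) + ((k - 3) choose 3)"
  proof -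
    have "k - 2 = Suc (k - 3)" using k by simp
    then show ?thesis by (simp add: numeral_eq_Suc)
  qed
  then have "((k - 2) choose 4) * (6 * ?q - 12)
      = (3 * ((k - 3) choose 4)) * (2 * ?q - 4) + (3 * ((k - 3) choose 3)) * (2 * ?q - 4)"
    using q by (simp add: algebra_simps diff_mult_distrib2)
  ultimately show ?thesis using N KmL k by linarith
qed

section \<open>Existence of complete generalized arcs\<close>

text \<open>The vectors \<open>e\<^sub>i\<close> and \<open>e\<^sub>i + e\<^sub>j\<close>, at which a quadratic form vanishes only if its
  coefficients do.\<close>

lemma six_points_generalized_arc:
  "\<exists>K :: ('a::{field,finite} ^ 3) set set. is_generalized_arc 6 K"
proof -
  define E :: "('a ^ 3) set" where "E = {vector [1,0,0], vector [0,1,0], vector [0,0,1],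
    vector [1,1,0], vector [1,0,1], vector [0,1,1]}"
  define K where "K = (\<lambda>v. vec.span {v}) ` E"
  have "card E = 6" by (simp add: E_def vec3_eq_iff)
  have nonzero: "v \<noteq> 0" if "v \<in> E" for v using that by (auto simp: E_def vec3_eq_iff)
  have "v = w" if "v \<in> E" "w \<in> E" "vec.span {v} = vec.span {w}" for v w
  proof -
    have "v \<in> range (\<lambda>k. k *s w)" using that by (metis vec.span_base singletonI vec.span_singleton)
    then obtain c where "v = c *s w" by blast
    then show ?thesis using that(1,2) by (auto simp: E_def vec3_eq_iff)
  qed
  then have "inj_on (\<lambda>v. vec.span {v}) E" by (auto intro: inj_onI)
  then have card: "card K = 6" by (simp add: K_def card_image \<open>card E = 6\<close>)
  have False if S: "S \<subseteq> K" "card S = 6" "is_conic C" "S \<subseteq> C" for S C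
  proof -
    have "S = K" using card_subset_eq[of K S] S card by simp
    obtain a b c d e f where C: "(a, b, c, d, e, f) \<noteq> (0, 0, 0, 0, 0, 0)"
      "C = zero_set (quadratic_form a b c d e f)"
      using S(3) unfolding is_conic_def by blast
    have "quadratic_form a b c d e f v = 0" if "v \<in> E" for v
    proof -
      have "vec.span {v} \<in> C" using that S \<open>S = K\<close> by (auto simp: K_def)
      then show ?thesis using C(2) vec.span_base[of v "{v}"] by (auto simp: zero_set_def)
    qed
    from this[of "vector [1,0,0]"] this[of "vector [0,1,0]"] this[of "vector [0,0,1]"]
      this[of "vector [1,1,0]"] this[of "vector [1,0,1]"] this[of "vector [0,1,1]"] C(1)
    show False by (simp add: E_def quadratic_form_def)
  qed
  moreover have "K \<subseteq> proj_plane" using nonzero by (auto simp: K_def proj_plane_def)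
  ultimately have "is_generalized_arc 6 K"
    using card unfolding is_generalized_arc_def by auto
  then show ?thesis ..
qed

text \<open>A generalized arc of the largest possible size is complete. Existence is what makes
  \<open>smallest_complete_size\<close> the size of an actual complete generalized arc, since \<open>LEAST\<close> is
  unspecified for an unsatisfiable property.\<close>

lemma complete_generalized_arc_exists:
  "\<exists>k (K :: ('a::{field,finite} ^ 3) set set). is_complete_generalized_arc k K"
proof -
  let ?A = "\<lambda>k. \<exists>K :: ('a ^ 3) set set. is_generalized_arc k K"
  \<comment> \<open>Sizes are bounded because the plane is finite.\<close>
  have bound: "k \<le> CARD(('a ^ 3) set)" if A: "?A k" for k
  proof -
    obtain K :: "('a ^ 3) set set" where "card K = k" using A by (auto simp: is_generalized_arc_def)
    then show ?thesis using card_mono[of UNIV K] by simp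
  qed
  obtain k where k: "?A k" "\<And>k'. ?A k' \<Longrightarrow> k' \<le> k"
    using GreatestI_nat[of ?A 6] Greatest_le_nat[of ?A] six_points_generalized_arc bound by metis
  then obtain K :: "('a ^ 3) set set" where K: "is_generalized_arc k K" by blast
  have "\<not> ?A (k + 1)" using k(2)[of "k + 1"] by auto
  then show ?thesis using K unfolding is_complete_generalized_arc_def by blast
qed

section \<open>The lower bounds on the size\<close>

text \<open>The counting inequality says that \<open>k\<close> itself solves the real inequality, so it is at least the
  infimum of the solutions. The truncated differences and integer binomial coefficients agree with
  the real ones because nothing is truncated.\<close>

lemma t1_le:
  assumes "5 \<le> q" "0 < k" "q\<^sup>2 + q + 1 \<le> (k choose 5) * (q - 4) + k"
  shows "t1 q \<le> real k"
proof -
  have "real (q\<^sup>2 + q + 1) \<le> real ((k choose 5) * (q - 4) + k)" using assms(3) of_nat_le_iff by blast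
  then have "real k \<in> solutions1 q"
    using assms by (simp add: solutions1_def binomial_gbinomial)
  then show ?thesis unfolding t1_def
    by (rule cInf_lower) (auto intro!: bdd_belowI[of _ 0] simp: solutions1_def)
qed

lemma t2_le:
  assumes "5 \<le> q" "3 \<le> k" "q\<^sup>2 + 3 \<le> ((k - 3) choose 5) * (q - 4)
    + ((k - 2) choose 4) * (6 * q - 12) + ((k - 3) choose 2) * (q - 2) + k"
  shows "t2 q \<le> real k"
proof -
  have "real (q\<^sup>2 + 3) \<le> real (((k - 3) choose 5) * (q - 4)
    + ((k - 2) choose 4) * (6 * q - 12) + ((k - 3) choose 2) * (q - 2) + k)"
    using assms(3) of_nat_le_iff by blast
  moreover have "real (k - 3) = real k - 3" "real (k - 2) = real k - 2"
    "real (6 * q - 12) = 6 * real q - 12" "real (q - 2) = real q - 2" "real (q - 4) = real q - 4"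
    using assms by simp_all
  ultimately have "real k \<in> solutions2 q"
    using assms by (simp add: solutions2_def binomial_gbinomial)
  then show ?thesis unfolding t2_def
    by (rule cInf_lower) (auto intro!: bdd_belowI[of _ 0] simp: solutions2_def)
qed

theorem theorem3:
  fixes q :: nat
  assumes "q = CARD('a::{field,finite})" and "q \<ge> 5"
  shows "(\<forall>(K :: ('a ^ 3) set set) (k :: nat). is_complete_generalized_arc k K \<longrightarrow>
            int k \<ge> (if is_arc k K then \<lceil>t1 q\<rceil> else \<lceil>t2 q\<rceil>)) \<and>
         int (smallest_complete_size TYPE('a)) \<ge> min \<lceil>t1 q\<rceil> \<lceil>t2 q\<rceil>"
proof
  have *: "(if is_arc k K then \<lceil>t1 q\<rceil> else \<lceil>t2 q\<rceil>) \<le> int k"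
    if K: "is_complete_generalized_arc k K" for K :: "('a ^ 3) set set" and k
  proof -
    have k: "6 \<le> k" using K by (simp add: is_complete_generalized_arc_def is_generalized_arc_def)
    show ?thesis
    proof (cases "is_arc k K")
      case True
      then show ?thesis using t1_le[of q k] complete_arc_bound[OF K True] assms k
        by (simp add: ceiling_le_iff)
    next
      case False
      then show ?thesis using t2_le[of q k] complete_nonarc_bound[OF K False] assms k
        by (simp add: ceiling_le_iff)
    qed
  qed
  then show "\<forall>(K :: ('a ^ 3) set set) k. is_complete_generalized_arc k K \<longrightarrow>
      int k \<ge> (if is_arc k K then \<lceil>t1 q\<rceil> else \<lceil>t2 q\<rceil>)" by blast
  let ?k = "smallest_complete_size TYPE('a)"
  have "\<exists>K :: ('a ^ 3) set set. is_complete_generalized_arc ?k K"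
    unfolding smallest_complete_size_def by (rule LeastI_ex) (rule complete_generalized_arc_exists)
  then show "int ?k \<ge> min \<lceil>t1 q\<rceil> \<lceil>t2 q\<rceil>" using * by (force split: if_splits)
qed

end
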